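(* Let $\mathbf V$ be a variety of algebras and $A\in\mathbf V$. Then for all $a,b\in A$, ${}_aR_b={}_aJ_b$ (as subgroups of ${}_a(\hat{\mathcal M}U_b)$).
   Context: A type $\Omega$ is a family of sets $\Omega_n$ ($n\in\mathbb{N}$, $0\in\mathbb N$) of $n$-ary operation symbols; algebras may be empty. Let $A$ be an algebra of type $\Omega$ in the variety $\mathbf V$. An $A$-module $M$ is an $|A|$-tuple of abelian groups $({}_aM)_{a\in A}$ with, for each $n$-ary $\omega$ and $\mathbf{a}\in A^n$, a group homomorphism $\omega^M_{\mathbf a}:{}_{\mathbf a}M\to{}_{\omega(\mathbf a)}M$, where ${}_{\mathbf a}M={}_{a_1}M\times\cdots\times{}_{a_n}M$. A pointed $A$-overalgebra $P$ is the same with pointed sets ${}_aP$ (basepoint ${}_a*$) and pointed maps instead. Given a pointed $A$-overalgebra $P$, let $\hat{\mathcal M}P$ be the $A$-module with ${}_a(\hat{\mathcal M}P)$ the free abelian group on the set ${}_aP$ (elements of ${}_aP$ identified with generators) and $\omega^{\hat{\mathcal M}P}_{\mathbf a}(\mathbf m)=\sum_{i}\omega^{\hat{\mathcal M}P}_{\mathbf a,i}(m_i)$, where $\omega^{\hat{\mathcal M}P}_{\mathbf a,i}:{}_{a_i}(\hat{\mathcal M}P)\to{}_{\omega(\mathbf a)}(\hat{\mathcal M}P)$ is the group homomorphism with $\omega^{\hat{\mathcal M}P}_{\mathbf a,i}(p)=\omega^P_{\mathbf a}({}_{a_1}*,\ldots,{}_{a_{i-1}}*,p,{}_{a_{i+1}}*,\ldots,{}_{a_n}*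 )$ for $p\in{}_{a_i}P$. Let $\mathcal KP$ be the smallest submodule of $\hat{\mathcal M}P$ (family of subgroups closed under all $\omega_{\mathbf a}$) containing every ${}_a*$ and every $\omega^P_{\mathbf a}(\mathbf p)-\sum_{i=1}^n\omega^{\hat{\mathcal M}P}_{\mathbf a,i}(p_i)$ ($\omega$ $n$-ary, $\mathbf a\in A^n$, $\mathbf p\in{}_{\mathbf a}P$). $\mathrm{Pol}_n(A,\mathbf V)$, the set of $n$-ary polynomials, is the (underlying set of the) coproduct in $\mathbf V$ of $A$ and the free algebra $\mathcal F_{\mathbf V}\{x_1,\ldots,x_n\}$. For $\Pi\in\mathrm{Pol}_n(A,\mathbf V)$, $B\in\mathbf V$ with a homomorphism $f:A\to B$, and $\mathbf b\in B^n$, $\Pi^{B,f}(\mathbf b)$ is the image of $\Pi$ under the unique homomorphism from the coproduct to $B$ extending $f$ and sending $x_i$ to $b_i$; for $\mathbf a\in A^n$, $\Pi(\mathbf a)=\Pi^{A,1_A}(\mathbf a)$. $U=\mathrm{Pol}_1(A,\mathbf V)$, with $x=x_1$ and insertion $\iota_A:A\to U$; one writes $a$ for $\iota_A(a)$. For $b\in A$, $U_b$ is the pointed $A$-overalgebra with ${}_aU_b=\{u\in U:u(b)=a\}$, basepoint $\iota_A(a)$, and $\omega^{U_b}_{\mathbf a}(\mathbf u)=\omega^U(\mathbf u)$. Put ${}_aJ_b={}_a(\mathcal KU_b)$. For $n\ge 0$, $\Pi\in\mathrm{Pol}_n(A,\mathbf V)$ and $b\in A$, put $$R_{\Pi,b}=\Pi^{U,\iota_A}(x,\ldots,x)-\sum_{j=1}^n\Pi^{U,\iota_A}(b,\ldots,b,x,b,\ldots,b),$$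 where in the $j$-th summand $x$ is the $j$-th argument, and the sum and difference are formal, taken in the free abelian group ${}_a(\hat{\mathcal M}U_b)$ on ${}_aU_b$ with $a=\Pi(b,\ldots,b)$. ${}_aR_b$ is the subgroup of ${}_a(\hat{\mathcal M}U_b)$ generated by the elements $R_{\Pi,b}$ for all $n\geq 0$ and all $n$-ary polynomials $\Pi$ with $\Pi(b,\ldots,b)=a$. *)

theory Defs
  imports "HOL-Algebra.Free_Abelian_Groups"
begin

section \<open>Algebras of a type\<close>

text \<open>A type of algebras is a family \<open>\<Omega> :: nat \<Rightarrow> 'f set\<close>; nothing prevents the same symbol
  from occurring in several \<open>\<Omega> n\<close>.  Arguments are passed as lists, so the length of the
  argument list tells which arity is meant.\<close>

record ('a, 'f) alg = "'a partial_object" +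
  oper :: "'f \<Rightarrow> 'a list \<Rightarrow> 'a"

definition tuples :: "'a set \<Rightarrow> nat \<Rightarrow> 'a list set" where
  "tuples X n = {xs. length xs = n \<and> set xs \<subseteq> X}"

definition algebra :: "(nat \<Rightarrow> 'f set) \<Rightarrow> ('a, 'f) alg \<Rightarrow> bool" where
  "algebra \<Omega> A \<longleftrightarrow>
     (\<forall>n. \<forall>f\<in>\<Omega> n. \<forall>as\<in>tuples (carrier A) n. oper A f as \<in> carrier A)"

text \<open>Homomorphisms are extensional functions on the carrier, so that a unique homomorphism
  is also unique as a HOL function.\<close>

definition alg_hom :: "(nat \<Rightarrow> 'f set) \<Rightarrow> ('a, 'f) alg \<Rightarrow> ('b, 'f) alg \<Rightarrow> ('a \<Rightarrow> 'b) set" where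
  "alg_hom \<Omega> A B = {h \<in> carrier A \<rightarrow>\<^sub>E carrier B.
     \<forall>n. \<forall>f\<in>\<Omega> n. \<forall>as\<in>tuples (carrier A) n. h (oper A f as) = oper B f (map h as)}"

definition alg_id :: "('a, 'f) alg \<Rightarrow> 'a \<Rightarrow> 'a" where
  "alg_id A = (\<lambda>a\<in>carrier A. a)"


section \<open>Terms and varieties\<close>

datatype ('f, 'v) trm = Var 'v | App 'f "('f, 'v) trm list"

inductive_set terms :: "(nat \<Rightarrow> 'f set) \<Rightarrow> 'v set \<Rightarrow> ('f, 'v) trm set"
  for \<Omega> :: "nat \<Rightarrow> 'f set" and X :: "'v set"
  where
    Var: "v \<in> X \<Longrightarrow> Var v \<in> terms \<Omega> X"
  | App: "f \<in> \<Omega> (length ts) \<Longrightarrow> \<forall>t\<in>set ts. t \<in> terms \<Omega> X \<Longrightarrow> App f ts \<in> terms \<Omega> X"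

definition term_alg :: "(nat \<Rightarrow> 'f set) \<Rightarrow> 'v set \<Rightarrow> (('f, 'v) trm, 'f) alg" where
  "term_alg \<Omega> X = \<lparr>carrier = terms \<Omega> X, oper = App\<rparr>"

primrec interp :: "('a, 'f) alg \<Rightarrow> ('v \<Rightarrow> 'a) \<Rightarrow> ('f, 'v) trm \<Rightarrow> 'a" where
  "interp A g (Var v) = g v"
| "interp A g (App f ts) = oper A f (map (interp A g) ts)"

text \<open>A class of algebras ranging over all types is not a HOL object, so a variety is given by
  a set of identities, in countably many variables.  Identities hold vacuously in an algebra
  with empty carrier; such an algebra exists only if \<open>\<Omega> 0\<close> is empty, and then every term
  contains a variable.\<close>

type_synonym 'f identities = "(('f, nat) trm \<times> ('f, nat) trm) set"

definition variety :: "(nat \<Rightarrow> 'f set) \<Rightarrow> 'f identities \<Rightarrow> bool" where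
  "variety \<Omega> V \<longleftrightarrow> V \<subseteq> terms \<Omega> UNIV \<times> terms \<Omega> UNIV"

definition in_variety :: "(nat \<Rightarrow> 'f set) \<Rightarrow> 'f identities \<Rightarrow> ('a, 'f) alg \<Rightarrow> bool" where
  "in_variety \<Omega> V A \<longleftrightarrow> algebra \<Omega> A \<and>
     (\<forall>(s, t)\<in>V. \<forall>g. range g \<subseteq> carrier A \<longrightarrow> interp A g s = interp A g t)"


section \<open>Algebras presented by generators and relations in a variety\<close>

inductive_set pcong ::
    "(nat \<Rightarrow> 'f set) \<Rightarrow> 'f identities \<Rightarrow> 'v set \<Rightarrow> (('f, 'v) trm \<times> ('f, 'v) trm) set \<Rightarrow>
     (('f, 'v) trm \<times> ('f, 'v) trm) set"
  for \<Omega> :: "nat \<Rightarrow> 'f set" and V :: "'f identities" and X :: "'v set"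
    and R :: "(('f, 'v) trm \<times> ('f, 'v) trm) set"
  where
    refl: "t \<in> terms \<Omega> X \<Longrightarrow> (t, t) \<in> pcong \<Omega> V X R"
  | sym: "(s, t) \<in> pcong \<Omega> V X R \<Longrightarrow> (t, s) \<in> pcong \<Omega> V X R"
  | trans: "(s, t) \<in> pcong \<Omega> V X R \<Longrightarrow> (t, u) \<in> pcong \<Omega> V X R \<Longrightarrow> (s, u) \<in> pcong \<Omega> V X R"
  | cong: "f \<in> \<Omega> (length ss) \<Longrightarrow> list_all2 (\<lambda>s t. (s, t) \<in> pcong \<Omega> V X R) ss ts \<Longrightarrow>
             (App f ss, App f ts) \<in> pcong \<Omega> V X R"
  | ident: "(s, t) \<in> V \<Longrightarrow> range \<sigma> \<subseteq> terms \<Omega> X \<Longrightarrow>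
             (interp (term_alg \<Omega> X) \<sigma> s, interp (term_alg \<Omega> X) \<sigma> t) \<in> pcong \<Omega> V X R"
  | rel: "(s, t) \<in> R \<Longrightarrow> s \<in> terms \<Omega> X \<Longrightarrow> t \<in> terms \<Omega> X \<Longrightarrow> (s, t) \<in> pcong \<Omega> V X R"
  monos list_all2_mono

definition presented ::
    "(nat \<Rightarrow> 'f set) \<Rightarrow> 'f identities \<Rightarrow> 'v set \<Rightarrow> (('f, 'v) trm \<times> ('f, 'v) trm) set \<Rightarrow>
     (('f, 'v) trm set, 'f) alg" where
  "presented \<Omega> V X R = \<lparr>carrier = terms \<Omega> X // pcong \<Omega> V X R,
     oper = (\<lambda>f cs. pcong \<Omega> V X R `` {App f (map (\<lambda>c. SOME t. t \<in> c) cs)})\<rparr>"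

definition gen ::
    "(nat \<Rightarrow> 'f set) \<Rightarrow> 'f identities \<Rightarrow> 'v set \<Rightarrow> (('f, 'v) trm \<times> ('f, 'v) trm) set \<Rightarrow>
     'v \<Rightarrow> ('f, 'v) trm set" where
  "gen \<Omega> V X R v = pcong \<Omega> V X R `` {Var v}"

definition free_alg :: "(nat \<Rightarrow> 'f set) \<Rightarrow> 'f identities \<Rightarrow> 'v set \<Rightarrow> (('f, 'v) trm set, 'f) alg" where
  "free_alg \<Omega> V X = presented \<Omega> V X {}"

definition free_gen :: "(nat \<Rightarrow> 'f set) \<Rightarrow> 'f identities \<Rightarrow> 'v set \<Rightarrow> 'v \<Rightarrow> ('f, 'v) trm set" where
  "free_gen \<Omega> V X = gen \<Omega> V X {}"

text \<open>The coproduct in the variety is generated by the disjoint union of the two carriers,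
  subject to the operation tables of both algebras.\<close>

definition coprod_rels ::
    "(nat \<Rightarrow> 'f set) \<Rightarrow> ('a, 'f) alg \<Rightarrow> ('b, 'f) alg \<Rightarrow>
     (('f, 'a + 'b) trm \<times> ('f, 'a + 'b) trm) set" where
  "coprod_rels \<Omega> A B =
     {(App f (map (\<lambda>a. Var (Inl a)) as), Var (Inl (oper A f as))) |n f as.
        f \<in> \<Omega> n \<and> as \<in> tuples (carrier A) n} \<union>
     {(App f (map (\<lambda>b. Var (Inr b)) bs), Var (Inr (oper B f bs))) |n f bs.
        f \<in> \<Omega> n \<and> bs \<in> tuples (carrier B) n}"

definition coprod ::
    "(nat \<Rightarrow> 'f set) \<Rightarrow> 'f identities \<Rightarrow> ('a, 'f) alg \<Rightarrow> ('b, 'f) alg \<Rightarrow>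
     (('f, 'a + 'b) trm set, 'f) alg" where
  "coprod \<Omega> V A B = presented \<Omega> V (carrier A <+> carrier B) (coprod_rels \<Omega> A B)"

definition coprod_inl ::
    "(nat \<Rightarrow> 'f set) \<Rightarrow> 'f identities \<Rightarrow> ('a, 'f) alg \<Rightarrow> ('b, 'f) alg \<Rightarrow>
     'a \<Rightarrow> ('f, 'a + 'b) trm set" where
  "coprod_inl \<Omega> V A B =
     (\<lambda>a\<in>carrier A. gen \<Omega> V (carrier A <+> carrier B) (coprod_rels \<Omega> A B) (Inl a))"

definition coprod_inr ::
    "(nat \<Rightarrow> 'f set) \<Rightarrow> 'f identities \<Rightarrow> ('a, 'f) alg \<Rightarrow> ('b, 'f) alg \<Rightarrow>
     'b \<Rightarrow> ('f, 'a + 'b) trm set" where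
  "coprod_inr \<Omega> V A B =
     (\<lambda>b\<in>carrier B. gen \<Omega> V (carrier A <+> carrier B) (coprod_rels \<Omega> A B) (Inr b))"


section \<open>Polynomials\<close>

text \<open>The variables \<open>x\<^sub>1, \<dots>, x\<^sub>n\<close> are numbered \<open>0, \<dots>, n - 1\<close>, in accordance with list indices.\<close>

type_synonym ('a, 'f) pol = "('f, 'a + ('f, nat) trm set) trm set"

definition Pol ::
    "(nat \<Rightarrow> 'f set) \<Rightarrow> 'f identities \<Rightarrow> ('a, 'f) alg \<Rightarrow> nat \<Rightarrow> (('a, 'f) pol, 'f) alg" where
  "Pol \<Omega> V A n = coprod \<Omega> V A (free_alg \<Omega> V {..<n})"

definition pol_const ::
    "(nat \<Rightarrow> 'f set) \<Rightarrow> 'f identities \<Rightarrow> ('a, 'f) alg \<Rightarrow> nat \<Rightarrow> 'a \<Rightarrow> ('a, 'f) pol" where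
  "pol_const \<Omega> V A n = coprod_inl \<Omega> V A (free_alg \<Omega> V {..<n})"

definition pol_var ::
    "(nat \<Rightarrow> 'f set) \<Rightarrow> 'f identities \<Rightarrow> ('a, 'f) alg \<Rightarrow> nat \<Rightarrow> nat \<Rightarrow> ('a, 'f) pol" where
  "pol_var \<Omega> V A n i =
     coprod_inr \<Omega> V A (free_alg \<Omega> V {..<n}) (free_gen \<Omega> V {..<n} i)"

definition pol_hom ::
    "(nat \<Rightarrow> 'f set) \<Rightarrow> 'f identities \<Rightarrow> ('a, 'f) alg \<Rightarrow> nat \<Rightarrow> ('b, 'f) alg \<Rightarrow> ('a \<Rightarrow> 'b) \<Rightarrow>
     'b list \<Rightarrow> ('a, 'f) pol \<Rightarrow> 'b" where
  "pol_hom \<Omega> V A n B f bs = (THE h. h \<in> alg_hom \<Omega> (Pol \<Omega> V A n) B \<and>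
     (\<forall>a\<in>carrier A. h (pol_const \<Omega> V A n a) = f a) \<and>
     (\<forall>i<n. h (pol_var \<Omega> V A n i) = bs ! i))"

text \<open>\<open>pol_eval \<Omega> V A n p B f bs\<close> is \<open>p\<^bsup>B,f\<^esup>(bs)\<close>; existence and uniqueness of the
  homomorphism involved is \<open>pol_universal\<close> below.\<close>

definition pol_eval ::
    "(nat \<Rightarrow> 'f set) \<Rightarrow> 'f identities \<Rightarrow> ('a, 'f) alg \<Rightarrow> nat \<Rightarrow> ('a, 'f) pol \<Rightarrow>
     ('b, 'f) alg \<Rightarrow> ('a \<Rightarrow> 'b) \<Rightarrow> 'b list \<Rightarrow> 'b" where
  "pol_eval \<Omega> V A n p B f bs = pol_hom \<Omega> V A n B f bs p"

abbreviation pol_at ::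
    "(nat \<Rightarrow> 'f set) \<Rightarrow> 'f identities \<Rightarrow> ('a, 'f) alg \<Rightarrow> nat \<Rightarrow> ('a, 'f) pol \<Rightarrow> 'a list \<Rightarrow> 'a" where
  "pol_at \<Omega> V A n p as \<equiv> pol_eval \<Omega> V A n p A (alg_id A) as"


section \<open>Modules and pointed overalgebras\<close>

text \<open>For \<open>as = [a\<^sub>1, \<dots>, a\<^sub>n]\<close>, this is the product \<open>F a\<^sub>1 \<times> \<dots> \<times> F a\<^sub>n\<close>.\<close>

definition fam_prod :: "('a \<Rightarrow> 'p set) \<Rightarrow> 'a list \<Rightarrow> 'p list set" where
  "fam_prod F as = {ps. list_all2 (\<lambda>p a. p \<in> F a) ps as}"

record ('a, 'f, 'm) amodule =
  mgrp :: "'a \<Rightarrow> 'm monoid"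
  mop :: "'f \<Rightarrow> 'a list \<Rightarrow> 'm list \<Rightarrow> 'm"

definition is_module ::
    "(nat \<Rightarrow> 'f set) \<Rightarrow> ('a, 'f) alg \<Rightarrow> ('a, 'f, 'm) amodule \<Rightarrow> bool" where
  "is_module \<Omega> A M \<longleftrightarrow> (\<forall>a\<in>carrier A. comm_group (mgrp M a)) \<and>
     (\<forall>n. \<forall>f\<in>\<Omega> n. \<forall>as\<in>tuples (carrier A) n.
        (\<forall>ms\<in>fam_prod (\<lambda>a. carrier (mgrp M a)) as.
           mop M f as ms \<in> carrier (mgrp M (oper A f as)) \<and>
           (\<forall>ms'\<in>fam_prod (\<lambda>a. carrier (mgrp M a)) as.
              mop M f as (map (\<lambda>i. ms ! i \<otimes>\<^bsub>mgrp M (as ! i)\<^esub> ms' ! i) [0..<n]) =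
              mop M f as ms \<otimes>\<^bsub>mgrp M (oper A f as)\<^esub> mop M f as ms')))"

definition submodule ::
    "(nat \<Rightarrow> 'f set) \<Rightarrow> ('a, 'f) alg \<Rightarrow> ('a, 'f, 'm) amodule \<Rightarrow> ('a \<Rightarrow> 'm set) \<Rightarrow> bool" where
  "submodule \<Omega> A M N \<longleftrightarrow> (\<forall>a\<in>carrier A. subgroup (N a) (mgrp M a)) \<and>
     (\<forall>n. \<forall>f\<in>\<Omega> n. \<forall>as\<in>tuples (carrier A) n. \<forall>ms\<in>fam_prod N as.
        mop M f as ms \<in> N (oper A f as))"

record ('a, 'f, 'p) overalg =
  fib :: "'a \<Rightarrow> 'p set"
  base :: "'a \<Rightarrow> 'p"
  oop :: "'f \<Rightarrow> 'a list \<Rightarrow> 'p list \<Rightarrow> 'p"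

definition pointed_overalgebra ::
    "(nat \<Rightarrow> 'f set) \<Rightarrow> ('a, 'f) alg \<Rightarrow> ('a, 'f, 'p) overalg \<Rightarrow> bool" where
  "pointed_overalgebra \<Omega> A P \<longleftrightarrow> (\<forall>a\<in>carrier A. base P a \<in> fib P a) \<and>
     (\<forall>n. \<forall>f\<in>\<Omega> n. \<forall>as\<in>tuples (carrier A) n.
        oop P f as \<in> fam_prod (fib P) as \<rightarrow> fib P (oper A f as) \<and>
        oop P f as (map (base P) as) = base P (oper A f as))"

definition Mhat_op ::
    "('a, 'f, 'p) overalg \<Rightarrow> 'f \<Rightarrow> 'a list \<Rightarrow> nat \<Rightarrow> ('p \<Rightarrow>\<^sub>0 int) \<Rightarrow> ('p \<Rightarrow>\<^sub>0 int)" where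
  "Mhat_op P f as i = frag_extend (\<lambda>p. frag_of (oop P f as ((map (base P) as)[i := p])))"

definition Mhat :: "('a, 'f, 'p) overalg \<Rightarrow> ('a, 'f, 'p \<Rightarrow>\<^sub>0 int) amodule" where
  "Mhat P = \<lparr>mgrp = (\<lambda>a. free_Abelian_group (fib P a)),
             mop = (\<lambda>f as ms. \<Sum>i<length as. Mhat_op P f as i (ms ! i))\<rparr>"

definition K_gens ::
    "(nat \<Rightarrow> 'f set) \<Rightarrow> ('a, 'f) alg \<Rightarrow> ('a, 'f, 'p) overalg \<Rightarrow> 'a \<Rightarrow> ('p \<Rightarrow>\<^sub>0 int) set" where
  "K_gens \<Omega> A P a = insert (frag_of (base P a))
     {frag_of (oop P f as ps) - (\<Sum>i<n. Mhat_op P f as i (frag_of (ps ! i))) |n f as ps.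
        f \<in> \<Omega> n \<and> as \<in> tuples (carrier A) n \<and> ps \<in> fam_prod (fib P) as \<and> oper A f as = a}"

text \<open>The smallest submodule containing \<open>K_gens\<close>; see \<open>K_submodule\<close> and \<open>K_least\<close>.\<close>

definition K_sub ::
    "(nat \<Rightarrow> 'f set) \<Rightarrow> ('a, 'f) alg \<Rightarrow> ('a, 'f, 'p) overalg \<Rightarrow> 'a \<Rightarrow> ('p \<Rightarrow>\<^sub>0 int) set" where
  "K_sub \<Omega> A P a = \<Inter>{N a |N. submodule \<Omega> A (Mhat P) N \<and> (\<forall>c\<in>carrier A. K_gens \<Omega> A P c \<subseteq> N c)}"


section \<open>The two families of subgroups\<close>

definition U_alg :: "(nat \<Rightarrow> 'f set) \<Rightarrow> 'f identities \<Rightarrow> ('a, 'f) alg \<Rightarrow> (('a, 'f) pol, 'f) alg" where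
  "U_alg \<Omega> V A = Pol \<Omega> V A 1"

definition U_x :: "(nat \<Rightarrow> 'f set) \<Rightarrow> 'f identities \<Rightarrow> ('a, 'f) alg \<Rightarrow> ('a, 'f) pol" where
  "U_x \<Omega> V A = pol_var \<Omega> V A 1 0"

definition U_const :: "(nat \<Rightarrow> 'f set) \<Rightarrow> 'f identities \<Rightarrow> ('a, 'f) alg \<Rightarrow> 'a \<Rightarrow> ('a, 'f) pol" where
  "U_const \<Omega> V A = pol_const \<Omega> V A 1"

definition U_over ::
    "(nat \<Rightarrow> 'f set) \<Rightarrow> 'f identities \<Rightarrow> ('a, 'f) alg \<Rightarrow> 'a \<Rightarrow> ('a, 'f, ('a, 'f) pol) overalg" where
  "U_over \<Omega> V A b =
     \<lparr>fib = (\<lambda>a. {u \<in> carrier (U_alg \<Omega> V A). pol_at \<Omega> V A 1 u [b] = a}),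
      base = U_const \<Omega> V A,
      oop = (\<lambda>f as us. oper (U_alg \<Omega> V A) f us)\<rparr>"

definition J_sub ::
    "(nat \<Rightarrow> 'f set) \<Rightarrow> 'f identities \<Rightarrow> ('a, 'f) alg \<Rightarrow> 'a \<Rightarrow> 'a \<Rightarrow> (('a, 'f) pol \<Rightarrow>\<^sub>0 int) set" where
  "J_sub \<Omega> V A b a = K_sub \<Omega> A (U_over \<Omega> V A b) a"

definition R_elem ::
    "(nat \<Rightarrow> 'f set) \<Rightarrow> 'f identities \<Rightarrow> ('a, 'f) alg \<Rightarrow> nat \<Rightarrow> ('a, 'f) pol \<Rightarrow> 'a \<Rightarrow>
     (('a, 'f) pol \<Rightarrow>\<^sub>0 int)" where
  "R_elem \<Omega> V A n p b =
     frag_of (pol_eval \<Omega> V A n p (U_alg \<Omega> V A) (U_const \<Omega> V A) (replicate n (U_x \<Omega> V A))) -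
     (\<Sum>j<n. frag_of (pol_eval \<Omega> V A n p (U_alg \<Omega> V A) (U_const \<Omega> V A)
                ((replicate n (U_const \<Omega> V A b))[j := U_x \<Omega> V A])))"

definition R_sub ::
    "(nat \<Rightarrow> 'f set) \<Rightarrow> 'f identities \<Rightarrow> ('a, 'f) alg \<Rightarrow> 'a \<Rightarrow> 'a \<Rightarrow> (('a, 'f) pol \<Rightarrow>\<^sub>0 int) set" where
  "R_sub \<Omega> V A b a = generate (mgrp (Mhat (U_over \<Omega> V A b)) a)
     {R_elem \<Omega> V A n p b |n p.
        p \<in> carrier (Pol \<Omega> V A n) \<and> pol_at \<Omega> V A n p (replicate n b) = a}"


section \<open>Adequacy of the constructions\<close>

lemma pcong_terms:
  assumes V: "variety \<Omega> V" and "(s, t) \<in> pcong \<Omega> V X R"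
  shows "s \<in> terms \<Omega> X \<and> t \<in> terms \<Omega> X"
proof -
  have sub: "interp (term_alg \<Omega> X) \<sigma> r \<in> terms \<Omega> X"
    if "r \<in> terms \<Omega> UNIV" "range \<sigma> \<subseteq> terms \<Omega> X" for r :: "('a, nat) trm" and \<sigma>
    using that(1)
    by induction (use that(2) in \<open>auto simp: term_alg_def intro!: terms.App\<close>)
  from assms(2) show ?thesis
  proof induction
    case (cong f ss ts)
    then show ?case
      by (auto intro!: terms.App simp: list_all2_conv_all_nth in_set_conv_nth)
  next
    case (ident s t \<sigma>)
    then show ?case using V sub by (auto simp: variety_def)
  qed auto
qed

lemma equiv_pcong:
  assumes "variety \<Omega> V"
  shows "equiv (terms \<Omega> X) (pcong \<Omega> V X R)"
  using pcong_terms[OF assms]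
  by (auto intro!: equivI refl_onI symI transI intro: pcong.refl pcong.sym pcong.trans)

text \<open>The operations of a presented algebra are the expected ones on classes.\<close>

lemma presented_oper:
  assumes V: "variety \<Omega> V" and f: "f \<in> \<Omega> (length ts)" and ts: "set ts \<subseteq> terms \<Omega> X"
  shows "oper (presented \<Omega> V X R) f (map (\<lambda>t. pcong \<Omega> V X R `` {t}) ts) =
         pcong \<Omega> V X R `` {App f ts}"
proof -
  let ?c = "\<lambda>t. pcong \<Omega> V X R `` {t}"
  have "(t, SOME s. s \<in> ?c t) \<in> pcong \<Omega> V X R" if "t \<in> set ts" for t
  proof -
    have "t \<in> ?c t" using that ts by (auto intro: pcong.refl)
    then have "(SOME s. s \<in> ?c t) \<in> ?c t" by (rule someI)
    then show ?thesis by simp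
  qed
  then have "(App f ts, App f (map (\<lambda>t. SOME s. s \<in> ?c t) ts)) \<in> pcong \<Omega> V X R"
    by (intro pcong.cong f) (auto simp: list_all2_conv_all_nth)
  from equiv_class_eq[OF equiv_pcong[OF V] this] show ?thesis
    by (simp add: presented_def comp_def)
qed

lemma presented_tuple:
  assumes "cs \<in> tuples (carrier (presented \<Omega> V X R)) n"
  obtains ts where "length ts = n" "set ts \<subseteq> terms \<Omega> X"
    "cs = map (\<lambda>t. pcong \<Omega> V X R `` {t}) ts"
proof -
  have "\<forall>c\<in>set cs. \<exists>t. t \<in> terms \<Omega> X \<and> c = pcong \<Omega> V X R `` {t}"
    using assms by (auto simp: tuples_def presented_def quotient_def)
  then obtain g where "\<forall>c\<in>set cs. g c \<in> terms \<Omega> X \<and> c = pcong \<Omega> V X R `` {g c}"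
    by metis
  then show ?thesis
    using assms by (intro that[of "map g cs"]) (auto simp: tuples_def intro!: map_idI[symmetric])
qed

lemma presented_in_variety:
  assumes V: "variety \<Omega> V"
  shows "in_variety \<Omega> V (presented \<Omega> V X R)"
proof -
  let ?P = "presented \<Omega> V X R" and ?c = "\<lambda>t. pcong \<Omega> V X R `` {t}"
  have "algebra \<Omega> ?P"
    unfolding algebra_def
  proof (intro allI ballI)
    fix n f cs assume f: "f \<in> \<Omega> n" and "cs \<in> tuples (carrier ?P) n"
    then obtain ts where ts: "length ts = n" "set ts \<subseteq> terms \<Omega> X" "cs = map ?c ts"
      by (elim presented_tuple)
    have "oper ?P f cs = ?c (App f ts)"
      using presented_oper[OF V, of f ts X R] f ts by simp
    moreover have "App f ts \<in> terms \<Omega> X"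
      using f ts by (auto intro!: terms.App)
    ultimately show "oper ?P f cs \<in> carrier ?P" by (auto simp: presented_def quotient_def)
  qed
  moreover have "interp ?P g s = interp ?P g t"
    if st: "(s, t) \<in> V" and g: "range g \<subseteq> carrier ?P" for s t g
  proof -
    have "\<forall>v. \<exists>t. t \<in> terms \<Omega> X \<and> g v = ?c t"
      using g by (auto simp: presented_def quotient_def image_subset_iff)
    then obtain \<sigma> where \<sigma>: "\<And>v. \<sigma> v \<in> terms \<Omega> X" "\<And>v. g v = ?c (\<sigma> v)"
      by metis
    have *: "interp (term_alg \<Omega> X) \<sigma> r \<in> terms \<Omega> X \<and>
             interp ?P g r = ?c (interp (term_alg \<Omega> X) \<sigma> r)"
      if "r \<in> terms \<Omega> UNIV" for r
      using that
    proof induction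
      case (App f ts)
      let ?ts = "map (interp (term_alg \<Omega> X) \<sigma>) ts"
      have "map (interp ?P g) ts = map ?c ?ts" using App by auto
      moreover have "oper ?P f (map ?c ?ts) = ?c (App f ?ts)"
        using App by (intro presented_oper V) auto
      ultimately have "interp ?P g (App f ts) = ?c (App f ?ts)"
        by (simp only: interp.simps)
      then show ?case using App
        by (simp add: term_alg_def terms.App)
    qed (auto simp: \<sigma>)
    have "(interp (term_alg \<Omega> X) \<sigma> s, interp (term_alg \<Omega> X) \<sigma> t) \<in> pcong \<Omega> V X R"
      using st \<sigma> by (intro pcong.ident) auto
    from equiv_class_eq[OF equiv_pcong[OF V] this]
    show ?thesis using * st V by (auto simp: variety_def)
  qed
  ultimately show ?thesis by (auto simp: in_variety_def)
qed

lemma presented_universal: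
  assumes V: "variety \<Omega> V" and B: "in_variety \<Omega> V B" and g: "g ` X \<subseteq> carrier B"
    and R: "\<And>s t. (s, t) \<in> R \<Longrightarrow> s \<in> terms \<Omega> X \<Longrightarrow> t \<in> terms \<Omega> X \<Longrightarrow> interp B g s = interp B g t"
  shows "\<exists>!h. h \<in> alg_hom \<Omega> (presented \<Omega> V X R) B \<and> (\<forall>v\<in>X. h (gen \<Omega> V X R v) = g v)"
proof -
  let ?P = "presented \<Omega> V X R" and ?c = "\<lambda>t. pcong \<Omega> V X R `` {t}"
  have closed: "interp B g t \<in> carrier B" if "t \<in> terms \<Omega> X" for t
    using that
  proof induction
    case (App f ts)
    then have "map (interp B g) ts \<in> tuples (carrier B) (length ts)" by (auto simp: tuples_def)
    then show ?case using App B by (auto simp: in_variety_def algebra_def)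
  qed (use g in auto)
  have subst: "interp B g (interp (term_alg \<Omega> X) \<sigma> r) = interp B (\<lambda>v. interp B g (\<sigma> v)) r" for \<sigma> r
    by (induction r) (auto simp: term_alg_def comp_def cong: map_cong)
  have resp: "interp B g s = interp B g t" if "(s, t) \<in> pcong \<Omega> V X R" for s t
    using that
  proof induction
    case (cong f ss ts)
    then have "map (interp B g) ss = map (interp B g) ts"
      by (auto simp: list_all2_conv_all_nth intro!: nth_equalityI)
    then show ?case by simp
  next
    case (ident s t \<sigma>)
    then have "range (\<lambda>v. interp B g (\<sigma> v)) \<subseteq> carrier B" using closed by auto
    then show ?case using ident B by (fastforce simp: in_variety_def subst)
  qed (auto intro: R)
  define h where "h = (\<lambda>c\<in>carrier ?P. interp B g (SOME t. t \<in> c))"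
  have car: "?c t \<in> carrier ?P" if "t \<in> terms \<Omega> X" for t
    using that by (auto simp: presented_def quotient_def)
  have h: "h (?c t) = interp B g t" if t: "t \<in> terms \<Omega> X" for t
  proof -
    have "t \<in> ?c t" using t by (auto intro: pcong.refl)
    then have "(SOME s. s \<in> ?c t) \<in> ?c t" by (rule someI)
    then show ?thesis using resp car[OF t] by (simp add: h_def)
  qed
  have ext: "h \<in> carrier ?P \<rightarrow>\<^sub>E carrier B"
  proof (rule PiE_I)
    fix c assume "c \<in> carrier ?P"
    then obtain t where "t \<in> terms \<Omega> X" "c = ?c t" by (auto simp: presented_def quotient_def)
    then show "h c \<in> carrier B" using h closed by simp
  qed (simp add: h_def)
  have "h \<in> alg_hom \<Omega> ?P B"
    unfolding alg_hom_def
  proof (intro CollectI conjI ext allI ballI)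
    fix n f cs assume f: "f \<in> \<Omega> n" and "cs \<in> tuples (carrier ?P) n"
    then obtain ts where ts: "length ts = n" "set ts \<subseteq> terms \<Omega> X" "cs = map ?c ts"
      by (elim presented_tuple)
    have "h (oper ?P f cs) = h (?c (App f ts))" using presented_oper[OF V, of f ts X R] f ts by simp
    also have "\<dots> = interp B g (App f ts)" using f ts by (intro h terms.App) auto
    also have "\<dots> = oper B f (map h cs)"
      using ts h by (auto simp: subset_iff intro!: arg_cong[where f = "oper B f"])
    finally show "h (oper ?P f cs) = oper B f (map h cs)" .
  qed
  moreover have "\<forall>v\<in>X. h (gen \<Omega> V X R v) = g v"
    using h[OF terms.Var] by (simp add: gen_def)
  moreover have "h' = h"
    if h': "h' \<in> alg_hom \<Omega> ?P B" "\<forall>v\<in>X. h' (gen \<Omega> V X R v) = g v" for h'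
  proof -
    have *: "h' (?c t) = interp B g t" if "t \<in> terms \<Omega> X" for t
      using that
    proof induction
      case (App f ts)
      have "map ?c ts \<in> tuples (carrier ?P) (length ts)"
        using App car by (auto simp: tuples_def)
      moreover have "?c (App f ts) = oper ?P f (map ?c ts)"
        using App by (subst presented_oper[OF V]) auto
      ultimately have "h' (?c (App f ts)) = oper B f (map h' (map ?c ts))"
        using h'(1) App unfolding alg_hom_def by auto
      also have "map h' (map ?c ts) = map (interp B g) ts" using App by auto
      finally show ?case by simp
    qed (use h'(2) in \<open>auto simp: gen_def\<close>)
    show ?thesis
    proof (rule PiE_ext)
      show "h' \<in> carrier ?P \<rightarrow>\<^sub>E carrier B" using h'(1) by (auto simp: alg_hom_def)
      fix c assume "c \<in> carrier ?P"
      then obtain t where "t \<in> terms \<Omega> X" "c = ?c t" by (auto simp: presented_def quotient_def)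
      then show "h' c = h c" using * h by simp
    qed (rule ext)
  qed
  ultimately show ?thesis by blast
qed

lemma gen_carrier: "v \<in> X \<Longrightarrow> gen \<Omega> V X R v \<in> carrier (presented \<Omega> V X R)"
  by (auto simp: gen_def presented_def quotient_def intro: terms.Var)

lemma free_universal:
  assumes "variety \<Omega> V" "in_variety \<Omega> V B" "g ` X \<subseteq> carrier B"
  shows "\<exists>!h. h \<in> alg_hom \<Omega> (free_alg \<Omega> V X) B \<and> (\<forall>v\<in>X. h (free_gen \<Omega> V X v) = g v)"
  unfolding free_alg_def free_gen_def using assms by (intro presented_universal) auto

lemma coprod_inl_hom:
  assumes V: "variety \<Omega> V" and A: "algebra \<Omega> A"
  shows "coprod_inl \<Omega> V A B \<in> alg_hom \<Omega> A (coprod \<Omega> V A B)"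
proof -
  let ?X = "carrier A <+> carrier B" and ?R = "coprod_rels \<Omega> A B"
  let ?c = "\<lambda>t. pcong \<Omega> V ?X ?R `` {t}"
  have "coprod_inl \<Omega> V A B (oper A f as) = oper (coprod \<Omega> V A B) f (map (coprod_inl \<Omega> V A B) as)"
    if f: "f \<in> \<Omega> n" and as: "as \<in> tuples (carrier A) n" for n f as
  proof -
    let ?ts = "map (\<lambda>a. Var (Inl a)) as :: ('a, 'b + 'c) trm list"
    have ts: "set ?ts \<subseteq> terms \<Omega> ?X" "f \<in> \<Omega> (length ?ts)" "oper A f as \<in> carrier A"
      using f as A by (auto simp: tuples_def algebra_def intro!: terms.Var)
    have "map (coprod_inl \<Omega> V A B) as = map ?c ?ts"
      using as by (auto simp: coprod_inl_def tuples_def gen_def)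
    then have "oper (coprod \<Omega> V A B) f (map (coprod_inl \<Omega> V A B) as) = ?c (App f ?ts)"
      using presented_oper[OF V ts(2,1)] by (simp only: coprod_def)
    moreover have "(App f ?ts, Var (Inl (oper A f as))) \<in> pcong \<Omega> V ?X ?R"
      using ts f as by (intro pcong.rel terms.App terms.Var) (auto simp: coprod_rels_def)
    ultimately show ?thesis
      using ts(3) by (simp only: coprod_inl_def gen_def restrict_apply' equiv_class_eq[OF equiv_pcong[OF V]])
  qed
  then show ?thesis
    by (auto simp: alg_hom_def coprod_inl_def coprod_def intro!: gen_carrier)
qed

lemma coprod_inr_hom:
  assumes V: "variety \<Omega> V" and B: "algebra \<Omega> B"
  shows "coprod_inr \<Omega> V A B \<in> alg_hom \<Omega> B (coprod \<Omega> V A B)"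
proof -
  let ?X = "carrier A <+> carrier B" and ?R = "coprod_rels \<Omega> A B"
  let ?c = "\<lambda>t. pcong \<Omega> V ?X ?R `` {t}"
  have "coprod_inr \<Omega> V A B (oper B f bs) = oper (coprod \<Omega> V A B) f (map (coprod_inr \<Omega> V A B) bs)"
    if f: "f \<in> \<Omega> n" and bs: "bs \<in> tuples (carrier B) n" for n f bs
  proof -
    let ?ts = "map (\<lambda>a. Var (Inr a)) bs :: ('a, 'c + 'b) trm list"
    have ts: "set ?ts \<subseteq> terms \<Omega> ?X" "f \<in> \<Omega> (length ?ts)" "oper B f bs \<in> carrier B"
      using f bs B by (auto simp: tuples_def algebra_def intro!: terms.Var)
    have "map (coprod_inr \<Omega> V A B) bs = map ?c ?ts"
      using bs by (auto simp: coprod_inr_def tuples_def gen_def)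
    then have "oper (coprod \<Omega> V A B) f (map (coprod_inr \<Omega> V A B) bs) = ?c (App f ?ts)"
      using presented_oper[OF V ts(2,1)] by (simp only: coprod_def)
    moreover have "(App f ?ts, Var (Inr (oper B f bs))) \<in> pcong \<Omega> V ?X ?R"
      using ts f bs by (intro pcong.rel terms.App terms.Var) (auto simp: coprod_rels_def)
    ultimately show ?thesis
      using ts(3) by (simp only: coprod_inr_def gen_def restrict_apply' equiv_class_eq[OF equiv_pcong[OF V]])
  qed
  then show ?thesis
    by (auto simp: alg_hom_def coprod_inr_def coprod_def intro!: gen_carrier)
qed

lemma coprod_universal:
  assumes V: "variety \<Omega> V" and A: "algebra \<Omega> A" and B: "algebra \<Omega> B" and C: "in_variety \<Omega> V C"
    and f: "f \<in> alg_hom \<Omega> A C" and g: "g \<in> alg_hom \<Omega> B C"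
  shows "\<exists>!h. h \<in> alg_hom \<Omega> (coprod \<Omega> V A B) C \<and>
    (\<forall>a\<in>carrier A. h (coprod_inl \<Omega> V A B a) = f a) \<and>
    (\<forall>b\<in>carrier B. h (coprod_inr \<Omega> V A B b) = g b)"
proof -
  let ?X = "carrier A <+> carrier B" and ?R = "coprod_rels \<Omega> A B"
  have im: "case_sum f g ` ?X \<subseteq> carrier C" using f g by (auto simp: alg_hom_def)
  have rel: "interp C (case_sum f g) s = interp C (case_sum f g) t" if "(s, t) \<in> ?R" for s t
    using that f g by (auto simp: coprod_rels_def alg_hom_def comp_def)
  have "(h \<in> alg_hom \<Omega> (coprod \<Omega> V A B) C \<and>
      (\<forall>a\<in>carrier A. h (coprod_inl \<Omega> V A B a) = f a) \<and>
      (\<forall>b\<in>carrier B. h (coprod_inr \<Omega> V A B b) = g b)) \<longleftrightarrow>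
    (h \<in> alg_hom \<Omega> (presented \<Omega> V ?X ?R) C \<and>
      (\<forall>v\<in>?X. h (gen \<Omega> V ?X ?R v) = case_sum f g v))" for h
    by (auto simp: coprod_def coprod_inl_def coprod_inr_def dest: bspec[OF _ InlI] bspec[OF _ InrI])
  then show ?thesis using presented_universal[OF V C im rel] by simp
qed

lemma pol_universal:
  assumes V: "variety \<Omega> V" and A: "in_variety \<Omega> V A" and B: "in_variety \<Omega> V B"
    and f: "f \<in> alg_hom \<Omega> A B" and bs: "bs \<in> tuples (carrier B) n"
  shows "\<exists>!h. h \<in> alg_hom \<Omega> (Pol \<Omega> V A n) B \<and>
    (\<forall>a\<in>carrier A. h (pol_const \<Omega> V A n a) = f a) \<and>
    (\<forall>i<n. h (pol_var \<Omega> V A n i) = bs ! i)"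
proof -
  let ?F = "free_alg \<Omega> V {..<n}"
  have F: "in_variety \<Omega> V ?F" unfolding free_alg_def by (rule presented_in_variety[OF V])
  have x: "free_gen \<Omega> V {..<n} i \<in> carrier ?F" if "i < n" for i
    unfolding free_alg_def free_gen_def using that by (intro gen_carrier) auto
  have inr: "coprod_inr \<Omega> V A ?F \<in> alg_hom \<Omega> ?F (coprod \<Omega> V A ?F)"
    using F by (intro coprod_inr_hom V) (auto simp: in_variety_def)
  have ex1: "\<exists>!k. k \<in> alg_hom \<Omega> ?F B \<and> (\<forall>i\<in>{..<n}. k (free_gen \<Omega> V {..<n} i) = bs ! i)"
    using bs by (intro free_universal V B) (auto simp: tuples_def subset_iff)
  then obtain k where k: "k \<in> alg_hom \<Omega> ?F B"
    "\<And>i. i < n \<Longrightarrow> k (free_gen \<Omega> V {..<n} i) = bs ! i" by auto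
  have iff: "(\<forall>i<n. h (pol_var \<Omega> V A n i) = bs ! i) \<longleftrightarrow>
      (\<forall>u\<in>carrier ?F. h (coprod_inr \<Omega> V A ?F u) = k u)"
    if h: "h \<in> alg_hom \<Omega> (Pol \<Omega> V A n) B" for h
  proof
    assume l: "\<forall>i<n. h (pol_var \<Omega> V A n i) = bs ! i"
    let ?k = "\<lambda>u\<in>carrier ?F. h (coprod_inr \<Omega> V A ?F u)"
    have "?k \<in> alg_hom \<Omega> ?F B"
    proof -
      have "?k (oper ?F f us) = oper B f (map ?k us)"
        if "f \<in> \<Omega> m" and us: "us \<in> tuples (carrier ?F) m" for m f us
      proof -
        let ?us = "map (coprod_inr \<Omega> V A ?F) us"
        have "?us \<in> tuples (carrier (coprod \<Omega> V A ?F)) m"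
          using us inr by (auto simp: tuples_def alg_hom_def)
        then have "h (oper (coprod \<Omega> V A ?F) f ?us) = oper B f (map h ?us)"
          using h that by (auto simp: alg_hom_def Pol_def)
        moreover have "coprod_inr \<Omega> V A ?F (oper ?F f us) = oper (coprod \<Omega> V A ?F) f ?us"
          using inr that by (auto simp: alg_hom_def)
        moreover have "oper ?F f us \<in> carrier ?F"
          using F that by (auto simp: in_variety_def algebra_def)
        moreover have "map ?k us = map h ?us" using us by (auto simp: tuples_def)
        ultimately show ?thesis by (simp only: restrict_apply')
      qed
      moreover have "?k \<in> carrier ?F \<rightarrow>\<^sub>E carrier B"
        using h inr by (auto simp: alg_hom_def Pol_def)
      ultimately show ?thesis by (auto simp: alg_hom_def)
    qed
    moreover have "\<forall>i\<in>{..<n}. ?k (free_gen \<Omega> V {..<n} i) = bs ! i"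
      using l x by (auto simp: pol_var_def)
    ultimately have "?k = k" using ex1 k by blast
    then show "\<forall>u\<in>carrier ?F. h (coprod_inr \<Omega> V A ?F u) = k u" by auto
  next
    assume "\<forall>u\<in>carrier ?F. h (coprod_inr \<Omega> V A ?F u) = k u"
    then show "\<forall>i<n. h (pol_var \<Omega> V A n i) = bs ! i" using x k by (auto simp: pol_var_def)
  qed
  have "\<exists>!h. h \<in> alg_hom \<Omega> (coprod \<Omega> V A ?F) B \<and>
    (\<forall>a\<in>carrier A. h (coprod_inl \<Omega> V A ?F a) = f a) \<and>
    (\<forall>u\<in>carrier ?F. h (coprod_inr \<Omega> V A ?F u) = k u)"
    using A F by (intro coprod_universal V B f k) (auto simp: in_variety_def)
  then show ?thesis using iff by (auto simp: Pol_def pol_const_def cong: conj_cong)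
qed

lemma pol_hom:
  assumes "variety \<Omega> V" "in_variety \<Omega> V A" "in_variety \<Omega> V B"
    and "f \<in> alg_hom \<Omega> A B" "bs \<in> tuples (carrier B) n"
  shows "pol_hom \<Omega> V A n B f bs \<in> alg_hom \<Omega> (Pol \<Omega> V A n) B"
    and "\<And>a. a \<in> carrier A \<Longrightarrow> pol_hom \<Omega> V A n B f bs (pol_const \<Omega> V A n a) = f a"
    and "\<And>i. i < n \<Longrightarrow> pol_hom \<Omega> V A n B f bs (pol_var \<Omega> V A n i) = bs ! i"
  using theI'[OF pol_universal[OF assms]] unfolding pol_hom_def by blast+

lemma alg_id_hom: "algebra \<Omega> A \<Longrightarrow> alg_id A \<in> alg_hom \<Omega> A A"
  by (auto simp: alg_hom_def alg_id_def algebra_def tuples_def subset_iff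
        intro!: arg_cong[where f = "oper A _"] map_idI[symmetric])

lemma fam_prod_nth: "ps \<in> fam_prod F as \<longleftrightarrow>
    length ps = length as \<and> (\<forall>i<length as. ps ! i \<in> F (as ! i))"
  by (auto simp: fam_prod_def list_all2_conv_all_nth)

lemma Mhat_op_closed:
  assumes P: "pointed_overalgebra \<Omega> A P" and f: "f \<in> \<Omega> n" "as \<in> tuples (carrier A) n" "i < n"
    and m: "Poly_Mapping.keys m \<subseteq> fib P (as ! i)"
  shows "Poly_Mapping.keys (Mhat_op P f as i m) \<subseteq> fib P (oper A f as)"
proof -
  have "oop P f as ((map (base P) as)[i := p]) \<in> fib P (oper A f as)"
    if "p \<in> fib P (as ! i)" for p
  proof -
    have "(map (base P) as)[i := p] \<in> fam_prod (fib P) as"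
      using P f that by (auto simp: fam_prod_nth nth_list_update tuples_def subset_iff
          pointed_overalgebra_def)
    then show ?thesis using P f unfolding pointed_overalgebra_def by blast
  qed
  then show ?thesis
    unfolding Mhat_op_def using m by (intro order_trans[OF keys_frag_extend]) auto
qed

lemma Mhat_module:
  assumes P: "pointed_overalgebra \<Omega> A P"
  shows "is_module \<Omega> A (Mhat P)"
proof -
  have cl: "Poly_Mapping.keys (\<Sum>i<n. Mhat_op P f as i (ms ! i)) \<subseteq> fib P (oper A f as)"
    if "f \<in> \<Omega> n" "as \<in> tuples (carrier A) n"
      "ms \<in> fam_prod (\<lambda>a. carrier (mgrp (Mhat P) a)) as" for n f as ms
    using that
    by (intro order_trans[OF keys_sum] UN_least Mhat_op_closed[OF P])
       (auto simp: fam_prod_nth Mhat_def tuples_def)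
  have mop: "mop (Mhat P) f as ms = (\<Sum>i<n. Mhat_op P f as i (ms ! i))"
    if "as \<in> tuples (carrier A) n" for n f as ms
    using that by (simp add: Mhat_def tuples_def)
  have mgrp: "mgrp (Mhat P) a = free_Abelian_group (fib P a)" for a
    by (simp add: Mhat_def)
  show ?thesis
    unfolding is_module_def
  proof (intro conjI ballI allI)
    fix n f as ms
    assume *: "f \<in> \<Omega> n" "as \<in> tuples (carrier A) n"
      "ms \<in> fam_prod (\<lambda>a. carrier (mgrp (Mhat P) a)) as"
    show "mop (Mhat P) f as ms \<in> carrier (mgrp (Mhat P) (oper A f as))"
      using cl[OF *] *(2) by (simp only: mop mgrp carrier_free_Abelian_group_iff)
    fix ms'
    show "mop (Mhat P) f as (map (\<lambda>i. ms ! i \<otimes>\<^bsub>mgrp (Mhat P) (as ! i)\<^esub> ms' ! i) [0..<n]) =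
      mop (Mhat P) f as ms \<otimes>\<^bsub>mgrp (Mhat P) (oper A f as)\<^esub> mop (Mhat P) f as ms'"
      using *(2) by (simp add: mop mgrp Mhat_op_def frag_extend_add sum.distrib)
  qed (simp add: mgrp abelian_free_Abelian_group)
qed

lemma K_gens_carrier:
  assumes A: "algebra \<Omega> A" and P: "pointed_overalgebra \<Omega> A P" and c: "c \<in> carrier A"
  shows "K_gens \<Omega> A P c \<subseteq> carrier (mgrp (Mhat P) c)"
proof -
  have "Poly_Mapping.keys (frag_of (oop P f as ps) - (\<Sum>i<n. Mhat_op P f as i (frag_of (ps ! i))))
      \<subseteq> fib P (oper A f as)"
    if f: "f \<in> \<Omega> n" "as \<in> tuples (carrier A) n" "ps \<in> fam_prod (fib P) as" for n f as ps
  proof -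
    have "oop P f as ps \<in> fib P (oper A f as)"
      using P f unfolding pointed_overalgebra_def by blast
    moreover have "Poly_Mapping.keys (\<Sum>i<n. Mhat_op P f as i (frag_of (ps ! i)))
        \<subseteq> fib P (oper A f as)"
      using f by (intro order_trans[OF keys_sum] UN_least Mhat_op_closed[OF P])
        (auto simp: fam_prod_nth tuples_def)
    ultimately show ?thesis by (intro order_trans[OF keys_diff]) auto
  qed
  then show ?thesis using P c by (auto simp: K_gens_def Mhat_def pointed_overalgebra_def)
qed

lemma K_least:
  assumes "submodule \<Omega> A (Mhat P) N" "\<And>c. c \<in> carrier A \<Longrightarrow> K_gens \<Omega> A P c \<subseteq> N c"
  shows "K_sub \<Omega> A P a \<subseteq> N a"
  unfolding K_sub_def by (rule Inter_lower) (use assms in blast)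

lemma K_submodule:
  assumes A: "algebra \<Omega> A" and P: "pointed_overalgebra \<Omega> A P"
  shows "submodule \<Omega> A (Mhat P) (K_sub \<Omega> A P)"
    and "a \<in> carrier A \<Longrightarrow> K_gens \<Omega> A P a \<subseteq> K_sub \<Omega> A P a"
proof -
  let ?S = "\<lambda>N. submodule \<Omega> A (Mhat P) N \<and> (\<forall>c\<in>carrier A. K_gens \<Omega> A P c \<subseteq> N c)"
  let ?F = "\<lambda>a. carrier (mgrp (Mhat P) a)"
  have grp: "group (mgrp (Mhat P) c)" for c by (simp add: Mhat_def)
  have top: "?S ?F"
    using Mhat_module[OF P] K_gens_carrier[OF A P] grp
    by (auto simp: submodule_def is_module_def group.subgroup_self)
  have "subgroup (K_sub \<Omega> A P c) (mgrp (Mhat P) c)" if "c \<in> carrier A" for c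
    unfolding K_sub_def using that top
    by (intro group.subgroups_Inter grp) (auto simp: submodule_def)
  moreover have "mop (Mhat P) f as ms \<in> K_sub \<Omega> A P (oper A f as)"
    if "f \<in> \<Omega> n" "as \<in> tuples (carrier A) n" "ms \<in> fam_prod (K_sub \<Omega> A P) as" for n f as ms
  proof -
    have "mop (Mhat P) f as ms \<in> N (oper A f as)" if "?S N" for N
    proof -
      have "ms \<in> fam_prod N as"
        using \<open>ms \<in> _\<close> \<open>?S N\<close> by (auto simp: fam_prod_nth K_sub_def)
      then show ?thesis using \<open>?S N\<close> \<open>f \<in> _\<close> \<open>as \<in> _\<close> by (auto simp: submodule_def)
    qed
    then show ?thesis by (auto simp: K_sub_def)
  qed
  ultimately show "submodule \<Omega> A (Mhat P) (K_sub \<Omega> A P)" by (auto simp: submodule_def)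
  show "K_gens \<Omega> A P a \<subseteq> K_sub \<Omega> A P a" if "a \<in> carrier A" using that by (auto simp: K_sub_def)
qed

lemma U_over_pointed:
  assumes V: "variety \<Omega> V" and A: "in_variety \<Omega> V A" and b: "b \<in> carrier A"
  shows "pointed_overalgebra \<Omega> A (U_over \<Omega> V A b)"
proof -
  let ?U = "U_alg \<Omega> V A"
  have A': "algebra \<Omega> A" using A by (simp add: in_variety_def)
  have U: "algebra \<Omega> ?U"
    unfolding U_alg_def Pol_def coprod_def
    by (rule conjunct1[OF presented_in_variety[OF V, unfolded in_variety_def]])
  have b': "[b] \<in> tuples (carrier A) 1" using b by (simp add: tuples_def)
  note ev = pol_hom[OF V A A alg_id_hom[OF A'] b', folded pol_eval_def U_alg_def]
  have \<iota>: "U_const \<Omega> V A \<in> alg_hom \<Omega> A ?U"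
    unfolding U_const_def pol_const_def U_alg_def Pol_def by (rule coprod_inl_hom[OF V A'])
  have oop: "oper ?U f us \<in> fib (U_over \<Omega> V A b) (oper A f as)"
    if f: "f \<in> \<Omega> n" "as \<in> tuples (carrier A) n" "us \<in> fam_prod (fib (U_over \<Omega> V A b)) as"
    for n f as us
  proof -
    have us: "us \<in> tuples (carrier ?U) n" "map (\<lambda>u. pol_at \<Omega> V A 1 u [b]) us = as"
      using f by (auto simp: fam_prod_nth tuples_def U_over_def in_set_conv_nth
          intro!: nth_equalityI)
    have "pol_hom \<Omega> V A 1 A (alg_id A) [b] (oper ?U f us) =
      oper A f (map (pol_hom \<Omega> V A 1 A (alg_id A) [b]) us)"
      using ev(1) f us by (auto simp: alg_hom_def)
    then show ?thesis using us U f by (auto simp: U_over_def pol_eval_def algebra_def)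
  qed
  have "U_const \<Omega> V A a \<in> fib (U_over \<Omega> V A b) a" if "a \<in> carrier A" for a
    using \<iota> that ev(2)[OF that] by (auto simp: U_over_def alg_hom_def U_const_def alg_id_def)
  then show ?thesis
    using \<iota> oop by (auto simp: pointed_overalgebra_def U_over_def alg_hom_def)
qed

end

theory Submission
  imports Defs
begin

text \<open>For \<open>R \<subseteq> J\<close>, one inducts on \<open>\<Pi>\<close>: if \<open>\<Pi> = \<omega>(\<Pi>\<^sub>1, \<dots>, \<Pi>\<^sub>m)\<close>, then modulo the generators
  of \<open>J\<close> the element \<open>R\<^bsub>\<Pi>,b\<^esub>\<close> is \<open>\<omega>\<close> applied to the tuple of the \<open>R\<close>-elements of the \<open>\<Pi>\<^sub>i\<close>.  For \<open>J \<subseteq> R\<close>, the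
  family \<open>R\<close> is a submodule, since \<open>\<omega>\<^bsub>a,i\<^esub>(R\<^bsub>\<Pi>,b\<^esub>) = R\<^bsub>\<Pi>',b\<^esub>\<close> for
  \<open>\<Pi>' = \<omega>(a\<^sub>1, \<dots>, \<Pi>, \<dots>, a\<^sub>m)\<close>, and it contains the generators of \<open>J\<close>: the basepoint \<open>a\<close>
  is \<open>R\<^bsub>\<Pi>,b\<^esub>\<close> for the nullary \<open>\<Pi> = a\<close>, and the generator given by \<open>\<omega>\<close> and \<open>p\<^sub>1, \<dots>, p\<^sub>n\<close> is
  \<open>R\<^bsub>\<Pi>,b\<^esub>\<close> for \<open>\<Pi> = \<omega>(p\<^sub>1(x\<^sub>1), \<dots>, p\<^sub>n(x\<^sub>n))\<close>.\<close>

section \<open>Subgroups of free abelian groups\<close>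

lemma subgroup_free_Abelian_group:
  assumes "subgroup H (free_Abelian_group S)"
  shows "0 \<in> H"
    and "u \<in> H \<Longrightarrow> v \<in> H \<Longrightarrow> u + v \<in> H"
    and "u \<in> H \<Longrightarrow> v \<in> H \<Longrightarrow> u - v \<in> H"
    and "u \<in> H \<Longrightarrow> - u \<in> H"
    and "(\<And>i. i \<in> I \<Longrightarrow> g i \<in> H) \<Longrightarrow> sum g I \<in> H"
proof -
  \<comment> \<open>The group inverse coincides with negation on elements supported in
    \<open>S\<close>; membership in \<open>H\<close> supplies that support.\<close>
  have keys: "Poly_Mapping.keys u \<subseteq> S" if "u \<in> H" for u
    using subgroup.mem_carrier[OF assms that] by simp
  show zero: "0 \<in> H" using subgroup.one_closed[OF assms] by simp
  show add: "u + v \<in> H" if "u \<in> H" "v \<in> H" for u v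
    using subgroup.m_closed[OF assms that] by simp
  show minus: "- u \<in> H" if "u \<in> H" for u
    using subgroup.m_inv_closed[OF assms that] keys[OF that] by simp
  show "u - v \<in> H" if "u \<in> H" "v \<in> H"
    using add[OF that(1) minus[OF that(2)]] by simp
  show "sum g I \<in> H" if "\<And>i. i \<in> I \<Longrightarrow> g i \<in> H"
    using that by (induction I rule: infinite_finite_induct) (auto simp: zero add)
qed

section \<open>Polynomials: induction and evaluation\<close>

locale variety_algebra =
  fixes \<Omega> :: "nat \<Rightarrow> 'f set" and V :: "'f identities" and A :: "('a, 'f) alg"
  assumes V: "variety \<Omega> V" and A: "in_variety \<Omega> V A"
begin

lemma algebra_A: "algebra \<Omega> A"
  using A by (simp add: in_variety_def)

lemma Pol_in_variety: "in_variety \<Omega> V (Pol \<Omega> V A n)"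
  unfolding Pol_def coprod_def by (rule presented_in_variety[OF V])

lemma oper_Pol_closed:
  "f \<in> \<Omega> m \<Longrightarrow> ps \<in> tuples (carrier (Pol \<Omega> V A n)) m \<Longrightarrow>
    oper (Pol \<Omega> V A n) f ps \<in> carrier (Pol \<Omega> V A n)"
  using Pol_in_variety[of n] by (auto simp: in_variety_def algebra_def)

lemma pol_const_hom: "pol_const \<Omega> V A n \<in> alg_hom \<Omega> A (Pol \<Omega> V A n)"
  unfolding pol_const_def Pol_def by (rule coprod_inl_hom[OF V algebra_A])

lemma pol_const_closed: "c \<in> carrier A \<Longrightarrow> pol_const \<Omega> V A n c \<in> carrier (Pol \<Omega> V A n)"
  using pol_const_hom by (auto simp: alg_hom_def)

lemma pol_var_closed:
  assumes "i < n"
  shows "pol_var \<Omega> V A n i \<in> carrier (Pol \<Omega> V A n)"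
proof -
  let ?F = "free_alg \<Omega> V {..<n}"
  have "algebra \<Omega> ?F"
    using presented_in_variety[OF V] by (auto simp: free_alg_def in_variety_def)
  moreover have "free_gen \<Omega> V {..<n} i \<in> carrier ?F"
    unfolding free_alg_def free_gen_def using assms by (intro gen_carrier) auto
  ultimately show ?thesis
    using coprod_inr_hom[OF V, of ?F A] by (auto simp: pol_var_def Pol_def alg_hom_def)
qed

text \<open>The polynomials satisfying \<open>P\<close> form a subalgebra; the universal homomorphism into it,
  followed by the inclusion, is the identity.\<close>

lemma Pol_induct [consumes 1, case_names const var oper]:
  assumes p: "p \<in> carrier (Pol \<Omega> V A n)"
    and const: "\<And>c. c \<in> carrier A \<Longrightarrow> P (pol_const \<Omega> V A n c)"
    and var: "\<And>i. i < n \<Longrightarrow> P (pol_var \<Omega> V A n i)"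
    and oper: "\<And>m f ps. f \<in> \<Omega> m \<Longrightarrow> ps \<in> tuples (carrier (Pol \<Omega> V A n)) m \<Longrightarrow>
      (\<And>q. q \<in> set ps \<Longrightarrow> P q) \<Longrightarrow> P (oper (Pol \<Omega> V A n) f ps)"
  shows "P p"
proof -
  let ?Q = "Pol \<Omega> V A n"
  let ?S = "?Q\<lparr>carrier := {p \<in> carrier ?Q. P p}\<rparr>"
  \<comment> \<open>Interpretation of terms never consults the carrier, so \<open>?S\<close>
    inherits the identities of \<open>?Q\<close> once it is closed under the operations.\<close>
  have interp: "interp ?S g t = interp ?Q g t" for g :: "nat \<Rightarrow> _" and t
    by (induction t) (auto cong: map_cong)
  have "algebra \<Omega> ?S"
    using oper oper_Pol_closed by (fastforce simp: algebra_def tuples_def)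
  then have S: "in_variety \<Omega> V ?S"
    using Pol_in_variety[of n] unfolding in_variety_def interp by (auto simp: subset_iff)
  have c: "pol_const \<Omega> V A n \<in> alg_hom \<Omega> A ?S"
    using pol_const_hom[of n] const by (auto simp: alg_hom_def)
  have v: "map (pol_var \<Omega> V A n) [0..<n] \<in> tuples (carrier ?S) n"
    using pol_var_closed var by (auto simp: tuples_def)
  from ex1_implies_ex[OF pol_universal[OF V A S c v]]
  obtain h where h: "h \<in> alg_hom \<Omega> ?Q ?S"
    "\<forall>a\<in>carrier A. h (pol_const \<Omega> V A n a) = pol_const \<Omega> V A n a"
    "\<forall>i<n. h (pol_var \<Omega> V A n i) = map (pol_var \<Omega> V A n) [0..<n] ! i"
    by auto
  have "h \<in> alg_hom \<Omega> ?Q ?Q" using h(1) by (auto simp: alg_hom_def)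
  moreover have "alg_id ?Q \<in> alg_hom \<Omega> ?Q ?Q"
    using Pol_in_variety by (intro alg_id_hom) (auto simp: in_variety_def)
  moreover have "map (pol_var \<Omega> V A n) [0..<n] \<in> tuples (carrier ?Q) n"
    using v by (auto simp: tuples_def)
  \<comment> \<open>Both are homomorphisms from \<open>?Q\<close> to itself fixing constants and
    variables, so both equal the one provided by the universal property.\<close>
  ultimately have "h = alg_id ?Q"
    using h(2,3) pol_const_closed pol_var_closed
    by (intro HOL.trans[OF HOL.sym[OF the1_equality] the1_equality,
          OF pol_universal[OF V A Pol_in_variety pol_const_hom] _
            pol_universal[OF V A Pol_in_variety pol_const_hom]])
      (auto simp: alg_id_def)
  with p h(1) show ?thesis by (auto simp: alg_id_def alg_hom_def)
qed

context
  fixes B :: "('b, 'f) alg" and f :: "'a \<Rightarrow> 'b" and bs :: "'b list" and n :: nat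
  assumes B: "in_variety \<Omega> V B" and f: "f \<in> alg_hom \<Omega> A B" and bs: "bs \<in> tuples (carrier B) n"
begin

lemma pol_eval_hom: "(\<lambda>p. pol_eval \<Omega> V A n p B f bs) \<in> alg_hom \<Omega> (Pol \<Omega> V A n) B"
  using pol_hom(1)[OF V A B f bs] by (simp add: pol_eval_def)

lemma pol_eval_closed: "p \<in> carrier (Pol \<Omega> V A n) \<Longrightarrow> pol_eval \<Omega> V A n p B f bs \<in> carrier B"
  using pol_eval_hom by (auto simp: alg_hom_def)

lemma pol_eval_const:
  "c \<in> carrier A \<Longrightarrow> pol_eval \<Omega> V A n (pol_const \<Omega> V A n c) B f bs = f c"
  using pol_hom(2)[OF V A B f bs] by (simp add: pol_eval_def)

lemma pol_eval_var: "i < n \<Longrightarrow> pol_eval \<Omega> V A n (pol_var \<Omega> V A n i) B f bs = bs ! i"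
  using pol_hom(3)[OF V A B f bs] by (simp add: pol_eval_def)

lemma pol_eval_oper:
  "g \<in> \<Omega> m \<Longrightarrow> ps \<in> tuples (carrier (Pol \<Omega> V A n)) m \<Longrightarrow>
    pol_eval \<Omega> V A n (oper (Pol \<Omega> V A n) g ps) B f bs =
    oper B g (map (\<lambda>p. pol_eval \<Omega> V A n p B f bs) ps)"
  using pol_eval_hom by (auto simp: alg_hom_def)

end

text \<open>Both sides are homomorphic in \<open>p\<close> and agree on constants and variables.
  This naturality is used for three maps \<open>h\<close>: \<open>\<iota>\<close>,
  \<open>\<pi>\<close>, and evaluation of n-ary polynomials in \<open>U\<close>.\<close>

lemma pol_eval_map:
  assumes B: "in_variety \<Omega> V B" and f: "f \<in> alg_hom \<Omega> A B" and bs: "bs \<in> tuples (carrier B) n"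
    and C: "in_variety \<Omega> V C" and k: "k \<in> alg_hom \<Omega> A C" and h: "h \<in> alg_hom \<Omega> B C"
    and hf: "\<And>a. a \<in> carrier A \<Longrightarrow> h (f a) = k a" and p: "p \<in> carrier (Pol \<Omega> V A n)"
  shows "h (pol_eval \<Omega> V A n p B f bs) = pol_eval \<Omega> V A n p C k (map h bs)"
proof -
  have cs: "map h bs \<in> tuples (carrier C) n" using bs h by (auto simp: tuples_def alg_hom_def)
  show ?thesis
    using p
  proof (induction rule: Pol_induct)
    case (const c)
    then show ?case by (simp add: hf pol_eval_const[OF B f bs] pol_eval_const[OF C k cs])
  next
    case (var i)
    then show ?case using bs
      by (simp add: pol_eval_var[OF B f bs] pol_eval_var[OF C k cs] tuples_def)
  next
    case (oper m g ps)
    have "map (\<lambda>p. pol_eval \<Omega> V A n p B f bs) ps \<in> tuples (carrier B) m"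
      using oper(2) pol_eval_closed[OF B f bs] by (auto simp: tuples_def)
    then have "h (oper B g (map (\<lambda>p. pol_eval \<Omega> V A n p B f bs) ps)) =
        oper C g (map (\<lambda>p. h (pol_eval \<Omega> V A n p B f bs)) ps)"
      using h oper(1) by (auto simp: alg_hom_def comp_def)
    also have "map (\<lambda>p. h (pol_eval \<Omega> V A n p B f bs)) ps =
        map (\<lambda>p. pol_eval \<Omega> V A n p C k (map h bs)) ps"
      using oper(3) by simp
    finally show ?case
      using oper(1,2) by (simp add: pol_eval_oper[OF B f bs] pol_eval_oper[OF C k cs])
  qed
qed

section \<open>The algebra of unary polynomials\<close>

text \<open>The arity of \<open>U\<close> is written \<open>1\<close>; rewriting it to
  \<open>Suc 0\<close> could keep facts about \<open>Pol \<Omega> V A 1\<close> from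
  matching.\<close>

lemmas [simp del] = One_nat_def

abbreviation U where "U \<equiv> U_alg \<Omega> V A"
abbreviation \<iota> where "\<iota> \<equiv> U_const \<Omega> V A"
abbreviation x where "x \<equiv> U_x \<Omega> V A"
abbreviation ev where "ev n p us \<equiv> pol_eval \<Omega> V A n p U \<iota> us"
abbreviation Q where "Q n \<equiv> Pol \<Omega> V A n"

lemma U_in_variety: "in_variety \<Omega> V U"
  unfolding U_alg_def by (rule Pol_in_variety)

lemma U_const_hom: "\<iota> \<in> alg_hom \<Omega> A U"
  unfolding U_alg_def U_const_def by (rule pol_const_hom)

lemma U_const_closed: "c \<in> carrier A \<Longrightarrow> \<iota> c \<in> carrier U"
  unfolding U_alg_def U_const_def by (rule pol_const_closed)

lemma U_x_closed: "x \<in> carrier U"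
  unfolding U_alg_def U_x_def by (rule pol_var_closed) simp

lemma alg_id_apply: "c \<in> carrier A \<Longrightarrow> alg_id A c = c"
  by (simp add: alg_id_def)

lemmas alg_id_A_hom = alg_id_hom[OF algebra_A]

lemmas ev_const = pol_eval_const[OF U_in_variety U_const_hom]
  and ev_var = pol_eval_var[OF U_in_variety U_const_hom]
  and ev_oper = pol_eval_oper[OF U_in_variety U_const_hom]
  and ev_closed = pol_eval_closed[OF U_in_variety U_const_hom]

lemma at_const:
  "as \<in> tuples (carrier A) n \<Longrightarrow> c \<in> carrier A \<Longrightarrow>
    pol_at \<Omega> V A n (pol_const \<Omega> V A n c) as = c"
  using pol_eval_const[OF A alg_id_A_hom] by (simp add: alg_id_apply)

lemmas at_var = pol_eval_var[OF A alg_id_A_hom]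
  and at_oper = pol_eval_oper[OF A alg_id_A_hom]
  and at_closed = pol_eval_closed[OF A alg_id_A_hom]

text \<open>Evaluation at \<open>[x]\<close> fixes the constants and the variable, which generate
  \<open>U\<close>. It later recovers the given elements \<open>us\<close> from the polynomial built
  out of them.\<close>

lemma ev_x: "u \<in> carrier U \<Longrightarrow> ev 1 u [x] = u"
proof -
  have x: "[x] \<in> tuples (carrier U) 1" using U_x_closed by (simp add: tuples_def)
  assume "u \<in> carrier U"
  then have "u \<in> carrier (Q 1)" by (simp add: U_alg_def)
  then show ?thesis
  proof (induction rule: Pol_induct)
    case (oper m f ps)
    then have "map (\<lambda>p. ev 1 p [x]) ps = ps" by (intro map_idI) auto
    with ev_oper[OF x oper(1,2)] show ?case by (simp add: U_alg_def)
  qed (use ev_const[OF x] ev_var[OF x] in \<open>auto simp: U_const_def U_x_def\<close>)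
qed

lemma ev_map_const:
  assumes "p \<in> carrier (Q n)" "as \<in> tuples (carrier A) n"
  shows "ev n p (map \<iota> as) = \<iota> (pol_at \<Omega> V A n p as)"
  using assms
  by (intro pol_eval_map[OF A alg_id_A_hom _ U_in_variety U_const_hom U_const_hom, symmetric])
    (auto simp: alg_id_apply)

section \<open>Evaluation at a fixed point b and the fibres over it\<close>

context
  fixes b :: 'a
  assumes b: "b \<in> carrier A"
begin

abbreviation \<pi> where "\<pi> u \<equiv> pol_at \<Omega> V A 1 u [b]"
abbreviation P where "P \<equiv> U_over \<Omega> V A b"

lemma b1: "[b] \<in> tuples (carrier A) 1"
  using b by (simp add: tuples_def)

lemma U_proj_hom: "\<pi> \<in> alg_hom \<Omega> U A"
  unfolding U_alg_def by (rule pol_eval_hom[OF A alg_id_A_hom b1])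

lemma U_proj_const: "c \<in> carrier A \<Longrightarrow> \<pi> (\<iota> c) = c"
  using at_const[OF b1] by (simp add: U_const_def)

lemma U_proj_x: "\<pi> x = b"
  using at_var[OF b1, of 0] by (simp add: U_x_def)

lemma U_proj_ev:
  assumes "p \<in> carrier (Q n)" "us \<in> tuples (carrier U) n"
  shows "\<pi> (ev n p us) = pol_at \<Omega> V A n p (map \<pi> us)"
  using assms
  by (intro pol_eval_map[OF U_in_variety U_const_hom _ A alg_id_A_hom U_proj_hom])
    (auto simp: alg_id_apply U_proj_const)

lemma replicate_b: "replicate n b \<in> tuples (carrier A) n"
  using b by (auto simp: tuples_def)

abbreviation xs where "xs n \<equiv> replicate n x"
abbreviation bxs where "bxs n j \<equiv> (replicate n (\<iota> b))[j := x]"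
abbreviation atb where "atb n p \<equiv> pol_at \<Omega> V A n p (replicate n b)"

lemma xs_closed: "xs n \<in> tuples (carrier U) n"
  using U_x_closed by (auto simp: tuples_def)

lemma bxs_closed: "bxs n j \<in> tuples (carrier U) n"
  using U_x_closed U_const_closed[OF b] set_update_subset_insert[of "replicate n (\<iota> b)" j x]
  by (auto simp: tuples_def)

lemma proj_xs: "map \<pi> (xs n) = replicate n b"
  by (simp add: U_proj_x)

lemma proj_bxs: "map \<pi> (bxs n j) = replicate n b"
proof (rule nth_equalityI)
  fix i assume "i < length (map \<pi> (bxs n j))"
  then show "map \<pi> (bxs n j) ! i = replicate n b ! i"
    by (cases "i = j") (auto simp: U_proj_x U_proj_const[OF b])
qed simp

text \<open>Both \<open>x\<close> and \<open>\<iota> b\<close> are sent to \<open>b\<close> by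
  \<open>\<pi>\<close>, so every argument tuple in \<open>R_elem\<close> projects to
  \<open>(b, ..., b)\<close>. All terms of \<open>R_elem\<close> therefore lie in one fibre.\<close>

lemma ev_fib:
  assumes "p \<in> carrier (Q n)"
  shows "ev n p (xs n) \<in> fib P (atb n p)" "ev n p (bxs n j) \<in> fib P (atb n p)"
  using assms ev_closed[OF xs_closed] ev_closed[OF bxs_closed]
    U_proj_ev[OF _ xs_closed] U_proj_ev[OF _ bxs_closed]
  unfolding proj_xs proj_bxs by (auto simp: U_over_def)

lemma R_elem_closed:
  assumes "p \<in> carrier (Q n)"
  shows "Poly_Mapping.keys (R_elem \<Omega> V A n p b) \<subseteq> fib P (atb n p)"
  unfolding R_elem_def using ev_fib[OF assms]
  by (intro order_trans[OF keys_diff] Un_least order_trans[OF keys_sum]) auto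

lemma P_pointed: "pointed_overalgebra \<Omega> A P"
  by (rule U_over_pointed[OF V A b])

lemma mgrp_P: "mgrp (Mhat P) c = free_Abelian_group (fib P c)"
  by (simp add: Mhat_def)

lemma R_sub_subgroup: "subgroup (R_sub \<Omega> V A b c) (free_Abelian_group (fib P c))"
  unfolding R_sub_def mgrp_P using R_elem_closed
  by (intro group.generate_is_subgroup) auto

lemma R_elem_in_R_sub:
  "p \<in> carrier (Q n) \<Longrightarrow> atb n p = c \<Longrightarrow> R_elem \<Omega> V A n p b \<in> R_sub \<Omega> V A b c"
  unfolding R_sub_def by (intro generate.incl) auto

section \<open>R is contained in J\<close>

lemma J_sub_submodule: "submodule \<Omega> A (Mhat P) (J_sub \<Omega> V A b)"
  using K_submodule(1)[OF algebra_A P_pointed] by (simp add: J_sub_def[abs_def])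

lemma J_sub_subgroup:
  "c \<in> carrier A \<Longrightarrow> subgroup (J_sub \<Omega> V A b c) (free_Abelian_group (fib P c))"
  using J_sub_submodule by (simp add: submodule_def mgrp_P)

lemma K_gens_J_sub: "c \<in> carrier A \<Longrightarrow> K_gens \<Omega> A P c \<subseteq> J_sub \<Omega> V A b c"
  using K_submodule(2)[OF algebra_A P_pointed] by (simp add: J_sub_def)

lemma J_sub_base: "c \<in> carrier A \<Longrightarrow> frag_of (\<iota> c) \<in> J_sub \<Omega> V A b c"
  using K_gens_J_sub[of c] by (auto simp: K_gens_def U_over_def)

lemma J_sub_oper:
  assumes "f \<in> \<Omega> n" "as \<in> tuples (carrier A) n" "us \<in> fam_prod (fib P) as"
  shows "frag_of (oper U f us) - (\<Sum>i<n. Mhat_op P f as i (frag_of (us ! i)))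
    \<in> J_sub \<Omega> V A b (oper A f as)"
proof -
  have "oper A f as \<in> carrier A" using algebra_A assms by (auto simp: algebra_def)
  moreover have "oop P f as us = oper U f us" by (simp add: U_over_def)
  ultimately show ?thesis using K_gens_J_sub assms by (fastforce simp: K_gens_def)
qed

lemma J_sub_mop:
  assumes "f \<in> \<Omega> n" "as \<in> tuples (carrier A) n" "ms \<in> fam_prod (J_sub \<Omega> V A b) as"
  shows "(\<Sum>i<n. Mhat_op P f as i (ms ! i)) \<in> J_sub \<Omega> V A b (oper A f as)"
  using J_sub_submodule assms by (fastforce simp: submodule_def Mhat_def tuples_def)

lemma R_elem_in_J_sub:
  assumes "p \<in> carrier (Q n)"
  shows "R_elem \<Omega> V A n p b \<in> J_sub \<Omega> V A b (atb n p)"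
  using assms
proof (induction rule: Pol_induct)
  case (const c)
  have at: "atb n (pol_const \<Omega> V A n c) = c"
    using const by (simp add: at_const[OF replicate_b])
  note J = subgroup_free_Abelian_group[OF J_sub_subgroup[OF const]]
  \<comment> \<open>A constant ignores its arguments, so every term of \<open>R_elem\<close> is the
    basepoint over \<open>c\<close>.\<close>
  show ?case
    unfolding R_elem_def ev_const[OF xs_closed const] ev_const[OF bxs_closed const] at
    by (intro J J_sub_base const)
next
  case (var i)
  have at: "atb n (pol_var \<Omega> V A n i) = b"
    using var by (simp add: at_var[OF replicate_b])
  note J = subgroup_free_Abelian_group[OF J_sub_subgroup[OF b]]
  \<comment> \<open>Only the summand \<open>j = i\<close> puts \<open>x\<close> at the variable. It
    cancels the leading \<open>x\<close>, leaving a multiple of the basepoint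
    \<open>\<iota> b\<close>.\<close>
  have "R_elem \<Omega> V A n (pol_var \<Omega> V A n i) b =
      frag_of x - (\<Sum>j<n. if j = i then frag_of x else frag_of (\<iota> b))"
    unfolding R_elem_def ev_var[OF xs_closed var] ev_var[OF bxs_closed var]
    using var by (intro arg_cong2[where f = "(-)"] sum.cong) (auto simp: nth_list_update)
  also have "\<dots> = - (\<Sum>j\<in>{..<n} - {i}. frag_of (\<iota> b))"
    using var by (simp add: sum.remove[of _ i])
  also have "\<dots> \<in> J_sub \<Omega> V A b b"
    by (intro J J_sub_base b)
  finally show ?case by (simp add: at)
next
  case (oper m f ps)
  define as where "as = map (atb n) ps"
  have ps: "length ps = m" "\<And>p. p \<in> set ps \<Longrightarrow> p \<in> carrier (Q n)"
    using oper(2) by (auto simp: tuples_def)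
  have as: "as \<in> tuples (carrier A) m"
    using ps at_closed[OF replicate_b] by (auto simp: as_def tuples_def)
  have at: "atb n (oper (Q n) f ps) = oper A f as"
    using oper(1,2) by (simp add: at_oper[OF replicate_b] as_def)
  have "oper A f as \<in> carrier A" using algebra_A oper(1) as by (auto simp: algebra_def)
  note J = subgroup_free_Abelian_group[OF J_sub_subgroup[OF this]]
  let ?u = "map (\<lambda>p. ev n p (xs n)) ps" and ?v = "\<lambda>j. map (\<lambda>p. ev n p (bxs n j)) ps"
  let ?M = "Mhat_op P f as"
  have u: "?u \<in> fam_prod (fib P) as" and v: "?v j \<in> fam_prod (fib P) as" for j
    using ps ev_fib by (auto simp: fam_prod_nth as_def)
  \<comment> \<open>Each \<open>?M i\<close> is additive; exchanging the two sums groups the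
    subtracted terms by the position \<open>j\<close> of \<open>x\<close>.\<close>
  have M: "(\<Sum>i<m. ?M i (R_elem \<Omega> V A n (ps ! i) b)) =
      (\<Sum>i<m. ?M i (frag_of (?u ! i))) - (\<Sum>j<n. \<Sum>i<m. ?M i (frag_of (?v j ! i)))"
    using ps
    by (subst sum.swap)
      (simp add: R_elem_def Mhat_op_def frag_extend_diff frag_extend_sum comp_def sum_subtractf)
  \<comment> \<open>The brackets are generators of \<open>J\<close>, one for \<open>?u\<close> and
    one for each \<open>?v j\<close>; the last line is the module operation applied to elements
    covered by the induction hypothesis. All these tuples lie over the same \<open>as\<close>, so
    the same maps \<open>?M i\<close> serve throughout.\<close>
  have "R_elem \<Omega> V A n (oper (Q n) f ps) b =
      (frag_of (oper U f ?u) - (\<Sum>i<m. ?M i (frag_of (?u ! i)))) -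
      (\<Sum>j<n. frag_of (oper U f (?v j)) - (\<Sum>i<m. ?M i (frag_of (?v j ! i)))) +
      (\<Sum>i<m. ?M i (R_elem \<Omega> V A n (ps ! i) b))"
    unfolding M R_elem_def[of _ _ _ _ "oper (Q n) f ps"]
      ev_oper[OF xs_closed oper(1,2)] ev_oper[OF bxs_closed oper(1,2)]
    by (simp add: sum_subtractf)
  also have "\<dots> \<in> J_sub \<Omega> V A b (oper A f as)"
  proof -
    have ms: "map (\<lambda>p. R_elem \<Omega> V A n p b) ps \<in> fam_prod (J_sub \<Omega> V A b) as"
      using ps oper(3) by (auto simp: fam_prod_nth as_def)
    have "(\<Sum>i<m. ?M i (R_elem \<Omega> V A n (ps ! i) b)) \<in> J_sub \<Omega> V A b (oper A f as)"
      using J_sub_mop[OF oper(1) as ms] ps by simp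
    then show ?thesis by (rule J(2)[OF J(3)[OF J_sub_oper[OF oper(1) as u] J(5)[OF J_sub_oper[OF oper(1) as v]]]])
  qed
  finally show ?case by (simp add: at)
qed

section \<open>J is contained in R\<close>

lemma Mhat_op_R_elem:
  assumes f: "f \<in> \<Omega> m" and as: "as \<in> tuples (carrier A) m" and i: "i < m"
    and p: "p \<in> carrier (Q n)" "atb n p = as ! i"
  shows "Mhat_op P f as i (R_elem \<Omega> V A n p b) \<in> R_sub \<Omega> V A b (oper A f as)"
proof -
  \<comment> \<open>At any tuple the constants take the values \<open>\<iota> (as ! k)\<close>, the
    basepoints that \<open>Mhat_op\<close> inserts at the places other than \<open>i\<close>. So
    \<open>Mhat_op\<close> carries one \<open>R_elem\<close> to the other term by term.\<close>
  define ps where "ps = (map (pol_const \<Omega> V A n) as)[i := p]"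
  have A': "c \<in> carrier A" if "c \<in> set as" for c using as that by (auto simp: tuples_def)
  have ps: "ps \<in> tuples (carrier (Q n)) m"
    using as p(1) pol_const_closed A'
      set_update_subset_insert[of "map (pol_const \<Omega> V A n) as" i p]
    by (auto simp: ps_def tuples_def)
  have ev: "map (\<lambda>p. ev n p us) ps = (map \<iota> as)[i := ev n p us]"
    if "us \<in> tuples (carrier U) n" for us
    using A' by (simp add: ps_def map_update ev_const[OF that] comp_def cong: map_cong)
  have "Mhat_op P f as i (R_elem \<Omega> V A n p b) = R_elem \<Omega> V A n (oper (Q n) f ps) b"
    by (simp add: R_elem_def Mhat_op_def frag_extend_diff frag_extend_sum comp_def U_over_def
        ev_oper[OF xs_closed f ps] ev_oper[OF bxs_closed f ps] ev[OF xs_closed] ev[OF bxs_closed])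
  moreover have "map (atb n) ps = as"
    using A' p(2) by (simp add: ps_def map_update at_const[OF replicate_b] comp_def cong: map_cong)
  then have "atb n (oper (Q n) f ps) = oper A f as"
    by (simp add: at_oper[OF replicate_b f ps])
  ultimately show ?thesis
    using oper_Pol_closed[OF f ps] by (simp add: R_elem_in_R_sub)
qed

text \<open>The map \<open>Mhat_op P f as i\<close> is additive, so the generators of
  \<open>R\<close> suffice. Since the operation of \<open>Mhat\<close> is a sum of such maps,
  closure in one argument at a time yields the submodule property.\<close>

lemma Mhat_op_R_sub:
  assumes f: "f \<in> \<Omega> m" and as: "as \<in> tuples (carrier A) m" and i: "i < m"
    and r: "r \<in> R_sub \<Omega> V A b (as ! i)"
  shows "Mhat_op P f as i r \<in> R_sub \<Omega> V A b (oper A f as)"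
proof -
  note R = subgroup_free_Abelian_group[OF R_sub_subgroup]
  show ?thesis
    using r unfolding R_sub_def[of _ _ _ _ "as ! i"] mgrp_P
  proof (induction rule: generate.induct)
    case one
    then show ?case by (simp add: Mhat_op_def R)
  next
    case (incl r)
    then show ?case using Mhat_op_R_elem[OF f as i] by auto
  next
    case (inv r)
    then obtain n p where r: "r = R_elem \<Omega> V A n p b" "p \<in> carrier (Q n)" "atb n p = as ! i"
      by auto
    with R_elem_closed[OF r(2)] show ?case
      using R(4)[OF Mhat_op_R_elem[OF f as i r(2,3)]]
      by (simp add: Mhat_op_def frag_extend_minus)
  next
    case (eng r s)
    then show ?case using R(2) by (simp add: Mhat_op_def frag_extend_add)
  qed
qed

lemma K_gens_oper_R_sub:
  assumes f: "f \<in> \<Omega> n" and as: "as \<in> tuples (carrier A) n" and us: "us \<in> fam_prod (fib P) as"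
  shows "frag_of (oop P f as us) - (\<Sum>i<n. Mhat_op P f as i (frag_of (us ! i)))
    \<in> R_sub \<Omega> V A b (oper A f as)"
proof -
  have len: "length as = n" "length us = n" using as us by (auto simp: tuples_def fam_prod_nth)
  have u: "us ! i \<in> carrier U" "\<pi> (us ! i) = as ! i" if "i < n" for i
    using us that len by (auto simp: fam_prod_nth U_over_def)
  \<comment> \<open>This is \<open>p_i(x_i)\<close>. Giving each \<open>us ! i\<close> its own
    variable lets a single \<open>x\<close> among copies of \<open>b\<close> isolate one
    summand.\<close>
  define q where "q i = pol_eval \<Omega> V A 1 (us ! i) (Q n) (pol_const \<Omega> V A n) [pol_var \<Omega> V A n i]" for i
  have var: "[pol_var \<Omega> V A n i] \<in> tuples (carrier (Q n)) 1" if "i < n" for i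
    using pol_var_closed[OF that] by (simp add: tuples_def)
  have q: "q i \<in> carrier (Q n)" if "i < n" for i
    unfolding q_def using u(1)[OF that]
    by (intro pol_eval_closed[OF Pol_in_variety pol_const_hom var[OF that]]) (simp add: U_alg_def)
  have ev: "ev n (q i) vs = ev 1 (us ! i) [vs ! i]"
    if i: "i < n" and vs: "vs \<in> tuples (carrier U) n" for i vs
  proof -
    \<comment> \<open>Naturality along evaluation at \<open>vs\<close>, which sends the i-th
      variable to \<open>vs ! i\<close>.\<close>
    have "ev n (q i) vs = ev 1 (us ! i) (map (\<lambda>p. ev n p vs) [pol_var \<Omega> V A n i])"
      unfolding q_def using u(1)[OF i]
      by (intro pol_eval_map[OF Pol_in_variety pol_const_hom var[OF i] U_in_variety U_const_hom
            pol_eval_hom[OF U_in_variety U_const_hom vs]] ev_const[OF vs]) (simp_all add: U_alg_def)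
    then show ?thesis using i by (simp add: ev_var[OF vs])
  qed
  define ps where "ps = map q [0..<n]"
  have ps: "ps \<in> tuples (carrier (Q n)) n" using q by (auto simp: ps_def tuples_def)
  have x: "map (\<lambda>p. ev n p (xs n)) ps = us"
    using len u ev[OF _ xs_closed] by (intro nth_equalityI) (auto simp: ps_def ev_x)
  \<comment> \<open>As \<open>us ! i\<close> lies over \<open>as ! i\<close>, putting
    \<open>b\<close> for its variable gives the basepoint of its fibre.\<close>
  have \<iota>: "ev 1 (us ! i) [\<iota> b] = \<iota> (as ! i)" if "i < n" for i
    using ev_map_const[OF _ b1] u[OF that] by (simp add: U_alg_def)
  \<comment> \<open>Entry \<open>j\<close> is \<open>us ! j\<close> and all others are basepoints:
    exactly the tuple to which \<open>Mhat_op\<close> at position \<open>j\<close> applies the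
    operation.\<close>
  have bx: "map (\<lambda>p. ev n p (bxs n j)) ps = (map \<iota> as)[j := us ! j]" for j
  proof (rule nth_equalityI)
    fix i assume "i < length (map (\<lambda>p. ev n p (bxs n j)) ps)"
    then show "map (\<lambda>p. ev n p (bxs n j)) ps ! i = (map \<iota> as)[j := us ! j] ! i"
      using len u ev[OF _ bxs_closed] by (cases "i = j") (auto simp: ps_def ev_x \<iota>)
  qed (simp add: ps_def len)
  have "frag_of (oop P f as us) - (\<Sum>i<n. Mhat_op P f as i (frag_of (us ! i))) =
      R_elem \<Omega> V A n (oper (Q n) f ps) b"
    by (simp add: R_elem_def ev_oper[OF xs_closed f ps] ev_oper[OF bxs_closed f ps] x bx
        Mhat_op_def U_over_def)
  \<comment> \<open>The values of \<open>ps\<close> at \<open>(b, ..., b)\<close> are the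
    projections of its values at \<open>(x, ..., x)\<close>, which are \<open>us\<close>.\<close>
  moreover have "map (atb n) ps = map \<pi> us"
    unfolding x[symmetric] using ps U_proj_ev[OF _ xs_closed, unfolded proj_xs]
    by (auto simp: tuples_def)
  then have "map (atb n) ps = as"
    using len u by (auto intro: nth_equalityI)
  then have "atb n (oper (Q n) f ps) = oper A f as"
    by (simp add: at_oper[OF replicate_b f ps])
  ultimately show ?thesis
    using oper_Pol_closed[OF f ps] by (simp add: R_elem_in_R_sub)
qed

lemma K_gens_R_sub:
  assumes c: "c \<in> carrier A"
  shows "K_gens \<Omega> A P c \<subseteq> R_sub \<Omega> V A b c"
proof -
  \<comment> \<open>In arity \<open>0\<close> the subtracted sum is empty.\<close>
  have "R_elem \<Omega> V A 0 (pol_const \<Omega> V A 0 c) b = frag_of (\<iota> c)"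
    using ev_const[OF xs_closed[of 0] c] by (simp add: R_elem_def)
  moreover have "atb 0 (pol_const \<Omega> V A 0 c) = c"
    using at_const[OF replicate_b c, of 0] .
  ultimately have "frag_of (base P c) \<in> R_sub \<Omega> V A b c"
    using R_elem_in_R_sub[OF pol_const_closed[OF c], of 0 c] by (simp add: U_over_def)
  then show ?thesis using K_gens_oper_R_sub by (auto simp: K_gens_def)
qed

lemma R_sub_submodule: "submodule \<Omega> A (Mhat P) (R_sub \<Omega> V A b)"
  unfolding submodule_def mgrp_P
proof (intro conjI ballI allI R_sub_subgroup)
  fix n f as ms
  assume *: "f \<in> \<Omega> n" "as \<in> tuples (carrier A) n" "ms \<in> fam_prod (R_sub \<Omega> V A b) as"
  then have "mop (Mhat P) f as ms = (\<Sum>i<n. Mhat_op P f as i (ms ! i))"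
    by (simp add: Mhat_def tuples_def)
  also have "\<dots> \<in> R_sub \<Omega> V A b (oper A f as)"
    using * by (intro subgroup_free_Abelian_group[OF R_sub_subgroup] Mhat_op_R_sub)
      (auto simp: fam_prod_nth tuples_def)
  finally show "mop (Mhat P) f as ms \<in> R_sub \<Omega> V A b (oper A f as)" .
qed

lemma R_sub_eq_J_sub:
  assumes a: "a \<in> carrier A"
  shows "R_sub \<Omega> V A b a = J_sub \<Omega> V A b a"
proof
  show "R_sub \<Omega> V A b a \<subseteq> J_sub \<Omega> V A b a"
    unfolding R_sub_def mgrp_P using R_elem_in_J_sub
    by (intro group.generate_subgroup_incl J_sub_subgroup a) auto
  show "J_sub \<Omega> V A b a \<subseteq> R_sub \<Omega> V A b a"
    unfolding J_sub_def by (intro K_least R_sub_submodule K_gens_R_sub)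
qed

end

end

theorem theorem11p1:
  fixes \<Omega> :: "nat \<Rightarrow> 'f set" and V :: "'f identities" and A :: "('a, 'f) alg" and a b :: 'a
  assumes "variety \<Omega> V" and "in_variety \<Omega> V A"
    and "a \<in> carrier A" and "b \<in> carrier A"
  shows "R_sub \<Omega> V A b a = J_sub \<Omega> V A b a"
  using assms by (intro variety_algebra.R_sub_eq_J_sub variety_algebra.intro)

end
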